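(* There is an algorithm that, given $n$ and a tuple $w\in\mathbb{Z}_+^n$ (encoded in binary), decides whether $w$ is a cyclic hyper degree, and runs in time polynomial in $n$.
   Context: $\mathbb{Z}_+$ denotes the nonnegative integers. For $m\ge0$ and $i\ge1$, $\mathrm{bin}(m,i)$ is the $i$-th bit of $m$ counted from the least significant bit. For $i\in[n]$, $c_{i,n}$ is the list of length $2^n$ with $c_{i,n}(j)=\mathrm{bin}(j-1,i)$. A cyclic permutation of order $k\ge0$ on $[m]$ is the map $i\mapsto 1+((i+k-1)\bmod m)$. For a list $\Pi=(\pi_1,\dots,\pi_n)$ of cyclic permutations of $[2^n]$ and $i\in[2^n]$, let $\Pi(T_n,i)=(c_{n,n}(\pi_n(i)),c_{n-1,n}(\pi_{n-1}(i)),\dots,c_{1,n}(\pi_1(i)))\in\{0,1\}^n$. A tuple $d\in\mathbb{Z}_+^n$ is a cyclic hyper degree if there exist such a list $\Pi$ and indices $i\le N$ in $[2^n]$ with $d=\sum_{k=i}^{N}\Pi(T_n,k)$. *)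

theory Defs
  imports Main "HOL-Computational_Algebra.Polynomial"
begin

section \<open>Cyclic hyper degrees\<close>

text \<open>The mathematical notions below are 1-based; lists are accessed by shifting the index.\<close>

definition bin :: "nat \<Rightarrow> nat \<Rightarrow> nat" where
  "bin m i = of_bool (bit m (i - 1))"

definition col :: "nat \<Rightarrow> nat \<Rightarrow> nat list" where
  "col i n = map (\<lambda>j. bin (j - 1) i) [1..<2 ^ n + 1]"

text \<open>Only the values of \<open>\<pi>\<close> on \<open>{1..m}\<close> are constrained; on this set \<open>i + k - 1\<close> does not truncate.\<close>

definition cyclic_perm :: "nat \<Rightarrow> (nat \<Rightarrow> nat) \<Rightarrow> bool" where
  "cyclic_perm m \<pi> \<longleftrightarrow> (\<exists>k. \<forall>i\<in>{1..m}. \<pi> i = 1 + (i + k - 1) mod m)"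

text \<open>Row \<open>i\<close> of the table \<open>T\<^sub>n\<close> after permuting its columns by \<open>\<Pi>\<close>; the columns are listed from
  number \<open>n\<close> down to number \<open>1\<close>.\<close>

definition perm_row :: "nat \<Rightarrow> (nat \<Rightarrow> nat) list \<Rightarrow> nat \<Rightarrow> nat list" where
  "perm_row n \<Pi> i = map (\<lambda>j. col j n ! ((\<Pi> ! (j - 1)) i - 1)) (rev [1..<n + 1])"

definition cyclic_hyper_degree :: "nat \<Rightarrow> nat list \<Rightarrow> bool" where
  "cyclic_hyper_degree n d \<longleftrightarrow>
     length d = n \<and>
     (\<exists>\<Pi> i N. length \<Pi> = n \<and> (\<forall>\<pi>\<in>set \<Pi>. cyclic_perm (2 ^ n) \<pi>) \<and>
        i \<in> {1..2 ^ n} \<and> N \<in> {1..2 ^ n} \<and> i \<le> N \<and>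
        (\<forall>j<n. d ! j = (\<Sum>k = i..N. perm_row n \<Pi> k ! j)))"

section \<open>Deterministic multi-tape Turing machines\<close>

text \<open>States, symbols and tapes are numbered from \<open>0\<close>; symbol \<open>0\<close> is the blank. Tapes are infinite in
  both directions, and tape \<open>0\<close> initially holds the input.\<close>

datatype move = MoveLeft | Stay | MoveRight

record tm =
  num_tapes :: nat
  num_symbols :: nat
  num_states :: nat
  init_state :: nat
  acc_state :: nat
  rej_state :: nat
  trans :: "nat \<Rightarrow> nat list \<Rightarrow> nat \<times> (nat \<times> move) list"

text \<open>The symbols \<open>1\<close>, \<open>2\<close>, \<open>3\<close> form the input alphabet (see \<open>encode\<close> below). Finiteness of the machine
  is the restriction of \<open>trans\<close> to finitely many states and symbols; its values elsewhere are never
  used.\<close>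

definition wf_tm :: "tm \<Rightarrow> bool" where
  "wf_tm M \<longleftrightarrow>
     num_tapes M \<ge> 1 \<and> num_symbols M \<ge> 4 \<and>
     init_state M < num_states M \<and> acc_state M < num_states M \<and> rej_state M < num_states M \<and>
     acc_state M \<noteq> rej_state M \<and>
     (\<forall>q ss q' acts. q < num_states M \<and> length ss = num_tapes M \<and> set ss \<subseteq> {..<num_symbols M} \<and>
        trans M q ss = (q', acts) \<longrightarrow>
        q' < num_states M \<and> length acts = num_tapes M \<and> fst ` set acts \<subseteq> {..<num_symbols M})"

type_synonym tape = "(int \<Rightarrow> nat) \<times> int"

type_synonym config = "nat \<times> tape list"

definition read_tape :: "tape \<Rightarrow> nat" where
  "read_tape t = fst t (snd t)"

fun move_head :: "move \<Rightarrow> int \<Rightarrow> int" where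
  "move_head MoveLeft h = h - 1"
| "move_head Stay h = h"
| "move_head MoveRight h = h + 1"

definition act_tape :: "nat \<times> move \<Rightarrow> tape \<Rightarrow> tape" where
  "act_tape a t = ((fst t)(snd t := fst a), move_head (snd a) (snd t))"

definition step :: "tm \<Rightarrow> config \<Rightarrow> config" where
  "step M c =
     (if fst c = acc_state M \<or> fst c = rej_state M then c
      else let (q', acts) = trans M (fst c) (map read_tape (snd c))
           in (q', map2 act_tape acts (snd c)))"

definition input_tape :: "nat list \<Rightarrow> tape" where
  "input_tape x = ((\<lambda>z. if 0 \<le> z \<and> z < int (length x) then x ! nat z else 0), 0)"

definition init_config :: "tm \<Rightarrow> nat list \<Rightarrow> config" where
  "init_config M x = (init_state M, input_tape x # replicate (num_tapes M - 1) (input_tape []))"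

definition run :: "tm \<Rightarrow> nat list \<Rightarrow> nat \<Rightarrow> config" where
  "run M x t = (step M ^^ t) (init_config M x)"

definition accepts_within :: "tm \<Rightarrow> nat list \<Rightarrow> nat \<Rightarrow> bool" where
  "accepts_within M x T \<longleftrightarrow> (\<exists>t\<le>T. fst (run M x t) = acc_state M)"

definition rejects_within :: "tm \<Rightarrow> nat list \<Rightarrow> nat \<Rightarrow> bool" where
  "rejects_within M x T \<longleftrightarrow> (\<exists>t\<le>T. fst (run M x t) = rej_state M)"

section \<open>Binary encoding of inputs\<close>

text \<open>Binary digits without superfluous leading zeros, most significant first; the number \<open>0\<close> has
  the single digit \<open>0\<close>.\<close>

fun binary :: "nat \<Rightarrow> nat list" where
  "binary m = (if m < 2 then [m] else binary (m div 2) @ [m mod 2])"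

declare binary.simps [simp del]

text \<open>The digits \<open>0\<close> and \<open>1\<close> become the symbols \<open>1\<close> and \<open>2\<close>; every number is terminated by the
  symbol \<open>3\<close>.\<close>

definition encode_num :: "nat \<Rightarrow> nat list" where
  "encode_num m = map Suc (binary m) @ [3]"

definition encode :: "nat \<Rightarrow> nat list \<Rightarrow> nat list" where
  "encode n w = encode_num n @ concat (map encode_num w)"

end

theory Submission
  imports Defs
begin

text \<open>
  Only the length \<open>l\<close> of the window is shared between the coordinates. For the column with bit
  position \<open>p\<close>, the sums over the windows of length \<open>l\<close> are the numbers between the number of
  \<open>t < l\<close> whose bit \<open>p\<close> is \<open>1\<close> and the number of those whose bit \<open>p\<close> is \<open>0\<close>. Inverting these
  counting functions, \<open>x\<close> is such a sum iff \<open>l\<close> is at most \<open>x\<close> with a bit \<open>1\<close> inserted at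
  position \<open>p\<close>, and \<open>x = 0\<close> or \<open>l\<close> exceeds \<open>x - 1\<close> with a bit \<open>0\<close> inserted there. So the tuple
  is a cyclic hyper degree iff the maximum of \<open>0\<close> and the lower bounds is less than the minimum of
  \<open>2 ^ n\<close> and the upper bounds. A Turing machine computes both by sweeps over a tape segment of
  \<open>n + 1\<close> cells, a constant number of sweeps for each coordinate.
\<close>

section \<open>Counting bits in intervals\<close>

text \<open>Counted from 0, this is the \<open>w\<close>-th number whose bit \<open>p\<close> is
  \<open>c\<close>; the recursion follows a sweep from the least significant digit.\<close>

fun insbit :: "bool \<Rightarrow> nat \<Rightarrow> nat \<Rightarrow> nat" where
  "insbit c 0 w = of_bool c + 2 * w"
| "insbit c (Suc p) w = w mod 2 + 2 * insbit c p (w div 2)"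

definition count_bit :: "bool \<Rightarrow> nat \<Rightarrow> nat \<Rightarrow> nat" where
  "count_bit c p x = (\<Sum>t<x. of_bool (bit t p = c))"

lemma count_bit_0 [simp]: "count_bit c p 0 = 0"
  by (simp add: count_bit_def)

lemma count_bit_Suc: "count_bit c p (Suc x) = count_bit c p x + of_bool (bit x p = c)"
  by (simp add: count_bit_def)

lemma count_bit_mono: "x \<le> y \<Longrightarrow> count_bit c p x \<le> count_bit c p y"
  unfolding count_bit_def by (rule sum_mono2) auto

lemma count_bit_position_0: "count_bit c 0 x = (x + of_bool (\<not> c)) div 2"
  by (induction x) (auto simp: count_bit_Suc bit_0 elim!: oddE evenE)

text \<open>Separate the \<open>t < x\<close> by parity: bit \<open>Suc p\<close> of
  \<open>2 * u\<close> and of \<open>2 * u + 1\<close> is bit \<open>p\<close> of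
  \<open>u\<close>.\<close>

lemma count_bit_Suc_position:
  "count_bit c (Suc p) x = count_bit c p (x div 2) + count_bit c p (Suc x div 2)"
  by (induction x) (auto simp: count_bit_Suc bit_Suc elim!: oddE evenE)

text \<open>Makes the window starting at 0 one with the fewest ones. Halving lowers
  \<open>p\<close>; if both lengths are odd, the floor of one half is paired with the ceiling of the
  other.\<close>

lemma count_bit_add:
  "count_bit True p s + count_bit True p l \<le> count_bit True p (s + l)"
proof (induction p arbitrary: s l)
  case 0
  then show ?case by (simp add: count_bit_position_0)
next
  case (Suc p)
  show ?case
  proof (cases "odd s \<and> odd l")
    case True
    then have e: "(s + l) div 2 = s div 2 + Suc l div 2" "Suc (s + l) div 2 = Suc s div 2 + l div 2"
      by (auto elim!: oddE)
    show ?thesis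
      using Suc.IH[of "s div 2" "Suc l div 2"] Suc.IH[of "Suc s div 2" "l div 2"]
      unfolding count_bit_Suc_position e by simp
  next
    case False
    then have e: "(s + l) div 2 = s div 2 + l div 2" "Suc (s + l) div 2 = Suc s div 2 + Suc l div 2"
      by (auto elim!: oddE evenE)
    show ?thesis
      using Suc.IH[of "s div 2" "l div 2"] Suc.IH[of "Suc s div 2" "Suc l div 2"]
      unfolding count_bit_Suc_position e by simp
  qed
qed

lemma count_bit_compl: "count_bit False p x + count_bit True p x = x"
  by (induction x) (auto simp: count_bit_Suc)

lemma bit_insbit: "bit (insbit c p w) p = c"
proof (induction p arbitrary: w)
  case (Suc p)
  have "insbit c (Suc p) w div 2 = insbit c p (w div 2)" by simp
  then show ?case using Suc.IH by (simp only: bit_Suc)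
qed (simp add: bit_0)

lemma count_bit_insbit: "count_bit c p (insbit c p w) = w"
proof (induction p arbitrary: w)
  case 0
  then show ?case by (auto simp: count_bit_position_0)
next
  case (Suc p)
  show ?case
  proof (cases "even w")
    case True
    then show ?thesis by (auto simp: count_bit_Suc_position Suc.IH elim!: evenE)
  next
    case False
    then have "w mod 2 = 1" by presburger
    \<comment> \<open>For odd \<open>w\<close> one of the two halves is longer by one, and its extra
      element has bit \<open>c\<close> by \<open>bit_insbit\<close>.\<close>
    with False show ?thesis
      by (auto simp: count_bit_Suc_position count_bit_Suc bit_Suc bit_insbit Suc.IH elim!: oddE)
  qed
qed

text \<open>The count is \<open>w\<close> at \<open>insbit c p w\<close> and \<open>w + 1\<close>
  right after it.\<close>

lemma count_bit_le_iff: "count_bit c p l \<le> w \<longleftrightarrow> l \<le> insbit c p w"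
proof
  assume "l \<le> insbit c p w"
  from count_bit_mono[OF this, of c p] show "count_bit c p l \<le> w"
    by (simp add: count_bit_insbit)
next
  assume *: "count_bit c p l \<le> w"
  show "l \<le> insbit c p w"
  proof (rule ccontr)
    assume "\<not> l \<le> insbit c p w"
    then have "count_bit c p (Suc (insbit c p w)) \<le> count_bit c p l"
      by (intro count_bit_mono) simp
    with * show False by (simp add: count_bit_Suc bit_insbit count_bit_insbit)
  qed
qed

lemma bit_add_exp: "bit (t + 2 ^ p) p \<longleftrightarrow> \<not> bit (t::nat) p"
  by (simp add: bit_iff_odd)

text \<open>Shifting the window by \<open>2 ^ p\<close> complements the bits, and shifting it by one changes the
  sum by at most one.\<close>

lemma window_sum_iff:
  "(\<exists>s::nat. w = (\<Sum>t<l. of_bool (bit (s + t) p))) \<longleftrightarrow>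
   count_bit True p l \<le> w \<and> w \<le> count_bit False p l"
proof -
  define D where "D s = (\<Sum>t<l. of_bool (bit (s + t) p) :: nat)" for s
  have D: "count_bit True p (s + l) = count_bit True p s + D s" for s
    unfolding count_bit_def D_def
    by (induction l) auto
  have compl: "D (s + 2 ^ p) + D s = l" for s
  proof -
    have "D (s + 2 ^ p) = (\<Sum>t<l. of_bool (\<not> bit (s + t) p))"
      unfolding D_def using bit_add_exp[of "s + _" p]
      by (intro sum.cong) (simp_all add: ac_simps)
    moreover have "(\<Sum>t<l. of_bool (\<not> bit (s + t) p)) + (\<Sum>t<l. of_bool (bit (s + t) p)) = l"
      by (induction l) (auto simp del: sum_of_bool_eq)
    ultimately show ?thesis unfolding D_def by argo
  qed
  \<comment> \<open>\<open>D\<close> is a difference of two prefix counts, so superadditivity bounds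
    it below; complementation turns this into the upper bound.\<close>
  have lower: "count_bit True p l \<le> D s" for s
    using count_bit_add[of p s l] D[of s] by simp
  have upper: "D s \<le> count_bit False p l" for s
    using lower[of "s + 2 ^ p"] compl[of s] count_bit_compl[of p l] by linarith
  have D0: "D 0 = count_bit True p l" using D[of 0] by simp
  have Dh: "D (2 ^ p) = count_bit False p l"
    using compl[of 0] D0 count_bit_compl[of p l] by simp
  have step: "\<bar>int (D (Suc s)) - int (D s)\<bar> \<le> 1" for s
  proof -
    have "D s + of_bool (bit (s + l) p) = of_bool (bit s p) + D (Suc s)"
      using D[of s] D[of "Suc s"] by (simp add: count_bit_Suc)
    then show ?thesis by (auto simp: of_bool_def split: if_splits)
  qed
  have "\<exists>s. w = D s" if "count_bit True p l \<le> w" "w \<le> count_bit False p l"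
  proof -
    have "\<exists>s\<le>2 ^ p. int (D s) = int w"
      by (rule nat0_intermed_int_val) (use step that D0 Dh in auto)
    then show ?thesis by (metis of_nat_eq_iff)
  qed
  then show ?thesis using lower upper unfolding D_def by blast
qed

section \<open>Windows of a common length and their admissible interval\<close>

lemma perm_row_nth:
  assumes "length \<Pi> = n" "j < n" "k \<in> {1..2 ^ n}" "(\<Pi> ! (n - Suc j)) k = 1 + (k + s - 1) mod 2 ^ n"
  shows "perm_row n \<Pi> k ! j = of_bool (bit (k + s - 1) (n - Suc j))"
proof -
  have rev: "rev [1..<n + 1] ! j = n - j"
    using assms(2) by (subst rev_nth) (auto simp del: upt_Suc)
  have "(k + s - 1) mod 2 ^ n < 2 ^ n" by simp
  then have "col (n - j) n ! ((k + s - 1) mod 2 ^ n) = bin ((k + s - 1) mod 2 ^ n) (n - j)"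
    unfolding col_def by (subst nth_map) (auto simp del: upt_Suc)
  \<comment> \<open>Reduction modulo \<open>2 ^ n\<close> keeps the bits below \<open>n\<close>, so
    a cyclic permutation acts as a plain shift.\<close>
  also have "\<dots> = of_bool (bit (k + s - 1) (n - Suc j))"
    using assms(2) by (simp add: bin_def bit_take_bit_iff flip: take_bit_eq_mod)
  finally show ?thesis
    unfolding perm_row_def using assms rev by (subst nth_map) (auto simp del: upt_Suc)
qed

lemma sum_interval_shift:
  fixes f :: "nat \<Rightarrow> nat"
  assumes "1 \<le> i" "i \<le> m"
  shows "(\<Sum>k = i..m. f (k + s - 1)) = (\<Sum>t<Suc m - i. f ((i + s - 1) + t))"
  by (rule sum.reindex_bij_witness[where i="\<lambda>t. i + t" and j="\<lambda>k. k - i"])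
    (use assms in \<open>auto simp: add.commute\<close>)

lemma cyclic_hyper_degree_iff_window:
  "cyclic_hyper_degree n w \<longleftrightarrow> length w = n \<and>
     (\<exists>l::nat\<in>{1..2 ^ n}. \<forall>j<n. \<exists>s::nat. w ! j = (\<Sum>t<l. of_bool (bit (s + t) (n - Suc j))))"
proof (intro iffI conjI)
  assume "cyclic_hyper_degree n w"
  then obtain \<Pi> i m where *: "length w = n" "length \<Pi> = n"
    "\<forall>\<pi>\<in>set \<Pi>. cyclic_perm (2 ^ n) \<pi>" "i \<in> {1..2 ^ n}" "m \<in> {1..2 ^ n}" "i \<le> m"
    "\<And>j. j < n \<Longrightarrow> w ! j = (\<Sum>k = i..m. perm_row n \<Pi> k ! j)"
    unfolding cyclic_hyper_degree_def by blast
  show "length w = n" by fact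
  show "\<exists>l::nat\<in>{1..2 ^ n}. \<forall>j<n. \<exists>s::nat. w ! j = (\<Sum>t<l. of_bool (bit (s + t) (n - Suc j)))"
  proof (intro bexI[of _ "Suc m - i"] allI impI)
    fix j assume j: "j < n"
    then have "cyclic_perm (2 ^ n) (\<Pi> ! (n - Suc j))" using * by simp
    then obtain s where s: "\<forall>k\<in>{1..2 ^ n}. (\<Pi> ! (n - Suc j)) k = 1 + (k + s - 1) mod 2 ^ n"
      unfolding cyclic_perm_def by blast
    have "w ! j = (\<Sum>k = i..m. of_bool (bit (k + s - 1) (n - Suc j)))"
      unfolding *(7)[OF j]
      by (intro sum.cong refl perm_row_nth) (use * j s in auto)
    also have "\<dots> = (\<Sum>t<Suc m - i. of_bool (bit ((i + s - 1) + t) (n - Suc j)))"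
      by (rule sum_interval_shift) (use * in auto)
    finally show "\<exists>s. w ! j = (\<Sum>t<Suc m - i. of_bool (bit (s + t) (n - Suc j)))" by blast
  qed (use * in auto)
next
  assume "length w = n \<and>
     (\<exists>l::nat\<in>{1..2 ^ n}. \<forall>j<n. \<exists>s::nat. w ! j = (\<Sum>t<l. of_bool (bit (s + t) (n - Suc j))))"
  then obtain l :: nat and s :: "nat \<Rightarrow> nat" where *: "length w = n" "l \<in> {1..2 ^ n}"
    "\<And>j. j < n \<Longrightarrow> w ! j = (\<Sum>t<l. of_bool (bit (s j + t) (n - Suc j)))"
    by metis
  \<comment> \<open>The window starts at row 1, where \<open>k + s - 1\<close> is the offset
    \<open>s\<close> itself; entry \<open>p\<close> of the list serves coordinate
    \<open>n - Suc p\<close>.\<close>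
  define \<Pi> where "\<Pi> = map (\<lambda>p k. 1 + (k + s (n - Suc p) - 1) mod 2 ^ n) [0..<n]"
  have "w ! j = (\<Sum>k = 1..l. perm_row n \<Pi> k ! j)" if j: "j < n" for j
  proof -
    have "(\<Sum>k = 1..l. perm_row n \<Pi> k ! j) = (\<Sum>k = 1..l. of_bool (bit (k + s j - 1) (n - Suc j)))"
    proof (intro sum.cong refl perm_row_nth)
      fix k
      have "n - Suc (n - Suc j) = j" using j by simp
      then show "(\<Pi> ! (n - Suc j)) k = 1 + (k + s j - 1) mod 2 ^ n"
        unfolding \<Pi>_def using j by simp
    qed (use * j in \<open>auto simp: \<Pi>_def\<close>)
    also have "\<dots> = (\<Sum>t<Suc l - 1. of_bool (bit ((1 + s j - 1) + t) (n - Suc j)))"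
      by (rule sum_interval_shift) (use * in auto)
    finally show ?thesis using *(3)[OF j] by simp
  qed
  moreover have "\<forall>\<pi>\<in>set \<Pi>. cyclic_perm (2 ^ n) \<pi>"
    unfolding \<Pi>_def cyclic_perm_def by auto
  moreover have "length \<Pi> = n" by (simp add: \<Pi>_def)
  ultimately show "cyclic_hyper_degree n w"
    unfolding cyclic_hyper_degree_def using * by (intro conjI exI[of _ \<Pi>] exI[of _ 1] exI[of _ l]) auto
qed

text \<open>The admissible window lengths \<open>l\<close> form the interval \<open>a < l \<le> b\<close>; a coordinate \<open>x\<close> followed
  by \<open>p\<close> others belongs to the column with bit position \<open>p\<close>.\<close>

fun feasible :: "nat \<Rightarrow> nat \<Rightarrow> nat list \<Rightarrow> bool" where
  "feasible a b [] \<longleftrightarrow> a < b"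
| "feasible a b (x # w) \<longleftrightarrow>
     feasible (max a (insbit False (length w) (x - 1))) (min b (insbit True (length w) x)) w"

text \<open>Justifies early rejection: \<open>a\<close> never decreases and \<open>b\<close> never
  increases.\<close>

lemma feasible_less: "feasible a b w \<Longrightarrow> a < b"
  by (induction w arbitrary: a b) fastforce+

lemma feasible_iff:
  "feasible a b w \<longleftrightarrow> (\<exists>l. a < l \<and> l \<le> b \<and>
     (\<forall>j<length w. insbit False (length w - Suc j) (w ! j - 1) < l \<and>
        l \<le> insbit True (length w - Suc j) (w ! j)))"
proof (induction w arbitrary: a b)
  case Nil
  then show ?case by (auto intro: exI[of _ b])
next
  case (Cons x w)
  show ?case
    unfolding feasible.simps Cons.IH by (intro ex_cong1) (auto simp: All_less_Suc2)
qed

lemma insbit_0: "insbit False p 0 = 0"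
  by (induction p) auto

text \<open>For \<open>w > 0\<close>, a count is at least \<open>w\<close> iff it is not at most
  \<open>w - 1\<close>. For \<open>w = 0\<close> truncation gives the bound 0, which
  \<open>0 < l\<close> meets.\<close>

lemma window_sum_iff_insbit:
  assumes "0 < l"
  shows "(\<exists>s::nat. w = (\<Sum>t<l. of_bool (bit (s + t) p))) \<longleftrightarrow>
     insbit False p (w - 1) < l \<and> l \<le> insbit True p w"
proof (cases "w = 0")
  case True
  then show ?thesis using insbit_0[of p] assms count_bit_le_iff[of True p l 0] unfolding window_sum_iff by simp
next
  case False
  then have "w \<le> count_bit False p l \<longleftrightarrow> insbit False p (w - 1) < l"
    using count_bit_le_iff[of False p l "w - 1"] by linarith
  then show ?thesis unfolding window_sum_iff count_bit_le_iff by blast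
qed

lemma cyclic_hyper_degree_iff_feasible:
  assumes "length w = n"
  shows "cyclic_hyper_degree n w \<longleftrightarrow> feasible 0 (2 ^ n) w"
proof -
  have "(l \<in> {1..2 ^ n} \<and> (\<forall>j<n. \<exists>s::nat. w ! j = (\<Sum>t<l. of_bool (bit (s + t) (n - Suc j))))) \<longleftrightarrow>
      (0 < l \<and> l \<le> 2 ^ n \<and> (\<forall>j<n. insbit False (n - Suc j) (w ! j - 1) < l \<and>
        l \<le> insbit True (n - Suc j) (w ! j)))" for l
    by (cases "0 < l") (simp_all add: window_sum_iff_insbit Suc_le_eq del: sum_of_bool_eq)
  then show ?thesis
    unfolding cyclic_hyper_degree_iff_window feasible_iff assms Bex_def using assms by simp
qed

text \<open>The number \<open>2 ^ p\<close> lies below \<open>2 ^ n\<close> and has bit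
  \<open>p\<close> set.\<close>

lemma count_bit_exp_less: "p < n \<Longrightarrow> count_bit False p (2 ^ n) < 2 ^ n"
proof -
  assume "p < n"
  then have "count_bit True p (Suc (2 ^ p)) \<le> count_bit True p (2 ^ n)"
    by (intro count_bit_mono) (simp add: Suc_leI)
  moreover have "0 < count_bit True p (Suc (2 ^ p))"
    by (simp add: count_bit_Suc bit_exp_iff)
  ultimately show ?thesis using count_bit_compl[of p "2 ^ n"] by simp
qed

text \<open>The largest sum over at most \<open>2 ^ n\<close> rows is a count of zeros, hence below
  \<open>2 ^ n\<close>. So coordinates of more than \<open>n\<close> digits may be rejected.\<close>

lemma infeasible_large:
  assumes "2 ^ n \<le> x" "length w < n" "b \<le> 2 ^ n"
  shows "\<not> feasible a b (x # w)"
proof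
  assume "feasible a b (x # w)"
  then have "insbit False (length w) (x - 1) < 2 ^ n"
    using feasible_less[of _ _ w] assms(3) by fastforce
  then have "x - 1 < count_bit False (length w) (2 ^ n)"
    using count_bit_le_iff[of False "length w" "2 ^ n" "x - 1"] by simp
  then show False using count_bit_exp_less[OF assms(2)] assms(1) by simp
qed

section \<open>Tapes with list contents\<close>

datatype frame_cell = Frame_Cell (low: bool) (high: bool) (new_low: bool) (new_high: bool) (mark: bool)

datatype symbol = Blank | Digit bool | Sep | Frame frame_cell

text \<open>The head is at position \<open>0\<close>.\<close>

type_synonym view = "int \<Rightarrow> symbol"

fun offset :: "move \<Rightarrow> int" where
  "offset MoveLeft = - 1"
| "offset Stay = 0"
| "offset MoveRight = 1"

text \<open>The tape is shifted instead of the head.\<close>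

definition act :: "symbol \<times> move \<Rightarrow> view \<Rightarrow> view" where
  "act a v = (\<lambda>k. (v(0 := fst a)) (k + offset (snd a)))"

text \<open>Both list arguments are listed outwards from the head. In \<open>facing_right l r\<close> the head reads
  the first symbol of \<open>r\<close>, in \<open>facing_left l r\<close> it reads the first symbol of \<open>l\<close>.\<close>

definition facing_right :: "symbol list \<Rightarrow> symbol list \<Rightarrow> view" where
  "facing_right l r =
     (\<lambda>k. if k \<ge> 0 then nth_default Blank r (nat k) else nth_default Blank l (nat (- k - 1)))"

definition facing_left :: "symbol list \<Rightarrow> symbol list \<Rightarrow> view" where
  "facing_left l r =
     (\<lambda>k. if k > 0 then nth_default Blank r (nat (k - 1)) else nth_default Blank l (nat (- k)))"

lemma nth_default_Cons_pos: "0 < n \<Longrightarrow> nth_default d (x # xs) n = nth_default d xs (n - 1)"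
  by (cases n) auto

lemma read_facing [simp]:
  "facing_right l (s # r) 0 = s"
  "facing_right l [] 0 = Blank"
  "facing_left (s # l) r 0 = s"
  "facing_left [] r 0 = Blank"
  by (auto simp: facing_right_def facing_left_def)

lemma act_facing [simp]:
  "act (s, MoveRight) (facing_right l (c # r)) = facing_right (s # l) r"
  "act (s, MoveRight) (facing_right l []) = facing_right (s # l) []"
  "act (s, MoveLeft) (facing_right l (c # r)) = facing_left l (s # r)"
  "act (s, MoveLeft) (facing_left (c # l) r) = facing_left l (s # r)"
  "act (s, MoveRight) (facing_left (c # l) r) = facing_right (s # l) r"
  by (rule ext; auto simp: act_def facing_right_def facing_left_def nth_default_Cons_pos
      nat_diff_distrib' algebra_simps intro!: arg_cong[of _ _ "nth_default Blank _"])+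

text \<open>Popping the stack leaves a blank that merges with the blank rest of the tape.\<close>

lemma facing_left_Blank [simp]: "facing_left l [Blank] = facing_left l []"
proof
  fix k
  show "facing_left l [Blank] k = facing_left l [] k"
    by (cases "nat (k - 1)") (simp_all add: facing_left_def)
qed

lemma act_Blank_facing [simp]:
  "act (Blank, MoveLeft) (facing_right l []) = facing_left l []"
  "act (Blank, MoveRight) (facing_left [] r) = facing_right [] r"
  by (rule ext; auto simp: act_def facing_right_def facing_left_def nth_default_Cons_pos
      nat_diff_distrib' algebra_simps intro!: arg_cong[of _ _ "nth_default Blank _"])+

lemma act_Stay [simp]: "act (v 0, Stay) v = v"
  by (auto simp: act_def)

lemma act_Stay_facing [simp]:
  "act (s, Stay) (facing_right l (s # r)) = facing_right l (s # r)"
  "act (Blank, Stay) (facing_right l []) = facing_right l []"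
  "act (s, Stay) (facing_left (s # l) r) = facing_left (s # l) r"
  "act (Blank, Stay) (facing_left [] r) = facing_left [] r"
  using act_Stay[of "facing_right l (s # r)"] act_Stay[of "facing_right l []"]
    act_Stay[of "facing_left (s # l) r"] act_Stay[of "facing_left [] r"] by simp_all

lemma facing_Nil: "facing_left [] [] = facing_right [] []"
  by (auto simp: facing_right_def facing_left_def)

section \<open>The machine\<close>

datatype state =
    Start
  | Forward bool
  | Decrement bool
  | Skip
  | Check bool
  | Push
  | To_End
  | Insert bool bool bool
  | Update bool bool bool
  | Accept
  | Reject

text \<open>Comparison from the least significant digit on: the last difference decides.\<close>

definition less_bit :: "bool \<Rightarrow> bool \<Rightarrow> bool \<Rightarrow> bool" where
  "less_bit lt a b = (if a = b then lt else b)"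

text \<open>Tape \<open>0\<close> is the input, tape \<open>1\<close> is a stack of digits, and tape \<open>2\<close> is a frame of
  \<open>n + 1\<close> cells, most significant cell first. The tracks \<open>low\<close> and \<open>high\<close> hold the bounds
  \<open>a\<close> and \<open>b\<close> of \<^const>\<open>feasible\<close>, the tracks \<open>new_low\<close> and \<open>new_high\<close> the bounds imposed by
  the current coordinate, and \<open>mark\<close> is the position at which the bit is inserted.

  \<open>Start\<close>, \<open>Forward\<close> and \<open>Decrement\<close> count \<open>n\<close> down and append a cell to the frame each time;
  the boolean says whether the next cell gets the mark. \<open>Check\<close> compares \<open>low\<close> with
  \<open>high\<close>. \<open>Push\<close> moves along the frame while it pushes a coordinate, so that a coordinate of
  excessive length is rejected in time. The booleans of \<open>Insert\<close> are the borrow of the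
  subtraction \<open>x - 1\<close> and the results so far of the comparisons \<open>low < new_low\<close> and
  \<open>new_high < high\<close>. Those of \<open>Update\<close> say which bounds are replaced and whether the next cell
  gets the mark.\<close>

fun delta :: "state \<Rightarrow> symbol \<Rightarrow> symbol \<Rightarrow> symbol \<Rightarrow>
    state \<times> (symbol \<times> move) \<times> (symbol \<times> move) \<times> (symbol \<times> move)" where
  "delta Start x y z =
     (Forward True, (x, Stay), (y, Stay), (Frame (Frame_Cell False True False False False), MoveRight))"
| "delta (Forward f) x y z =
     (case x of Sep \<Rightarrow> (Decrement f, (Sep, MoveLeft), (y, Stay), (z, Stay))
      | _ \<Rightarrow> (Forward f, (x, MoveRight), (y, Stay), (z, Stay)))"
| "delta (Decrement f) x y z =
     (case x of
        Digit d \<Rightarrow>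
          if d then (Forward False, (Digit False, MoveRight), (y, Stay),
            (Frame (Frame_Cell False False False False f), MoveRight))
          else (Decrement f, (Digit True, MoveLeft), (y, Stay), (z, Stay))
      | _ \<Rightarrow> (Skip, (x, MoveRight), (y, Stay), (z, Stay)))"
| "delta Skip x y z =
     (case x of Sep \<Rightarrow> (Check False, (Sep, MoveRight), (y, Stay), (z, MoveLeft))
      | _ \<Rightarrow> (Skip, (x, MoveRight), (y, Stay), (z, Stay)))"
| "delta (Check lt) x y z =
     (case z of
        Frame c \<Rightarrow>
          (Check (less_bit lt (low c) (high c)), (x, Stay), (y, Stay), (z, MoveLeft))
      | _ \<Rightarrow> if lt then (Push, (x, Stay), (y, Stay), (z, MoveRight))
             else (Reject, (x, Stay), (y, Stay), (z, Stay)))"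
| "delta Push x y z =
     (case x of
        Digit d \<Rightarrow>
          (case z of Frame c \<Rightarrow> (Push, (x, MoveRight), (Digit d, MoveRight), (z, MoveRight))
           | _ \<Rightarrow> (Reject, (x, Stay), (y, Stay), (z, Stay)))
      | Sep \<Rightarrow> (To_End, (x, MoveRight), (y, MoveLeft), (z, Stay))
      | _ \<Rightarrow> (Accept, (x, Stay), (y, Stay), (z, Stay)))"
| "delta To_End x y z =
     (case z of Frame c \<Rightarrow> (To_End, (x, Stay), (y, Stay), (z, MoveRight))
      | _ \<Rightarrow> (Insert True False False, (x, Stay), (y, Stay), (z, MoveLeft)))"
| "delta (Insert br gt lt) x y z =
     (case z of
        Frame c \<Rightarrow>
          if mark c then
            (Insert br (less_bit gt (low c) False) (less_bit lt True (high c)),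
              (x, Stay), (y, Stay), (Frame (Frame_Cell (low c) (high c) False True True), MoveLeft))
          else (case (case y of Digit d \<Rightarrow> (d, Blank, MoveLeft) | _ \<Rightarrow> (False, y, Stay)) of (d, y') \<Rightarrow>
            (Insert (br \<and> \<not> d) (less_bit gt (low c) (d \<noteq> br)) (less_bit lt d (high c)),
              (x, Stay), y', (Frame (Frame_Cell (low c) (high c) (d \<noteq> br) d False), MoveLeft)))
      | _ \<Rightarrow>
          (case y of
             Blank \<Rightarrow> (Update (gt \<and> \<not> br) lt False, (x, Stay), (y, Stay), (z, MoveRight))
           | _ \<Rightarrow> (Reject, (x, Stay), (y, Stay), (z, Stay))))"
| "delta (Update g l m) x y z =
     (case z of
        Frame c \<Rightarrow>
          (Update g l (mark c), (x, Stay), (y, Stay),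
            (Frame (Frame_Cell (if g then new_low c else low c) (if l then new_high c else high c)
               (new_low c) (new_high c) m), MoveRight))
      | _ \<Rightarrow> (Check False, (x, Stay), (y, Stay), (z, MoveLeft)))"
| "delta Accept x y z = (Accept, (x, Stay), (y, Stay), (z, Stay))"
| "delta Reject x y z = (Reject, (x, Stay), (y, Stay), (z, Stay))"

section \<open>Runs on head-centred tapes, with time bounds\<close>

fun vstep :: "state \<times> view \<times> view \<times> view \<Rightarrow> state \<times> view \<times> view \<times> view" where
  "vstep (q, x, y, z) =
     (case delta q (x 0) (y 0) (z 0) of (q', a, b, c) \<Rightarrow> (q', act a x, act b y, act c z))"

definition steps :: "nat \<Rightarrow> state \<times> view \<times> view \<times> view \<Rightarrow> state \<times> view \<times> view \<times> view \<Rightarrow> bool" where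
  "steps T c d \<longleftrightarrow> (\<exists>t\<le>T. (vstep ^^ t) c = d)"

lemma steps_refl: "steps T c c"
  unfolding steps_def by (intro exI[of _ 0]) auto

lemma steps_trans: "steps T c d \<Longrightarrow> steps U d e \<Longrightarrow> T + U \<le> V \<Longrightarrow> steps V c e"
  unfolding steps_def
proof (elim exE conjE)
  fix t u
  assume "t \<le> T" "u \<le> U" "(vstep ^^ t) c = d" "(vstep ^^ u) d = e" "T + U \<le> V"
  then show "\<exists>t\<le>V. (vstep ^^ t) c = e"
    by (intro exI[of _ "u + t"]) (auto simp: funpow_add)
qed

lemma steps_step: "vstep c = d \<Longrightarrow> steps T d e \<Longrightarrow> T < V \<Longrightarrow> steps V c e"
  by (rule steps_trans[of 1 c d T]) (auto simp: steps_def intro!: exI[of _ 1])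

lemma steps_Suc: "vstep c = d \<Longrightarrow> steps T d e \<Longrightarrow> steps (Suc T) c e"
  by (rule steps_step) auto

lemma steps_1: "vstep c = d \<Longrightarrow> 0 < T \<Longrightarrow> steps T c d"
  by (rule steps_step[OF _ steps_refl])

subsection \<open>Building the frame\<close>

lemma forward_digits:
  "steps (length ds) (Forward f, facing_right l (map Digit ds @ r), y, z)
     (Forward f, facing_right (rev (map Digit ds) @ l) r, y, z)"
  by (induction ds arbitrary: l) (auto intro: steps_refl steps_Suc)

fun decrement :: "bool list \<Rightarrow> bool list" where
  "decrement [] = []"
| "decrement (True # e) = False # e"
| "decrement (False # e) = True # decrement e"

abbreviation val :: "bool list \<Rightarrow> nat" where
  "val \<equiv> horner_sum of_bool 2"

lemma val_decrement: "0 < val e \<Longrightarrow> val (decrement e) = val e - 1"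
  by (induction e rule: decrement.induct) auto

lemma length_decrement [simp]: "length (decrement e) = length e"
  by (induction e rule: decrement.induct) auto

text \<open>The borrow travels left to the lowest \<open>True\<close> and the head travels back,
  hence the factor 2. The cell is appended on finding that \<open>True\<close>, so once per
  unit.\<close>

lemma decrement_pos:
  "0 < val e \<Longrightarrow> steps (2 * length e)
     (Decrement f, facing_left (map Digit e) r, y, facing_right c [])
     (Forward False, facing_right (map Digit (decrement e)) r, y,
       facing_right (Frame (Frame_Cell False False False False f) # c) [])"
proof (induction e arbitrary: r)
  case (Cons b e)
  show ?case
  proof (cases b)
    case True
    then show ?thesis by (intro steps_1) auto
  next
    case False
    with Cons have IH: "steps (2 * length e)
       (Decrement f, facing_left (map Digit e) (Digit True # r), y, facing_right c [])
       (Forward False, facing_right (map Digit (decrement e)) (Digit True # r), y,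
         facing_right (Frame (Frame_Cell False False False False f) # c) [])" by auto
    show ?thesis
      by (rule steps_step[OF _ steps_trans[OF IH steps_1[OF _ zero_less_one] order.refl]])
        (use False in auto)
  qed
qed simp

text \<open>The failing subtraction leaves garbage \<open>e'\<close> behind; from here on the input
  head never moves left.\<close>

lemma decrement_0:
  "val e = 0 \<Longrightarrow> \<exists>e'. steps (2 * length e + 1)
     (Decrement f, facing_left (map Digit e) r, y, z) (Skip, facing_right e' r, y, z)"
proof (induction e arbitrary: r)
  case Nil
  show ?case by (rule exI[of _ "[]"], rule steps_1) auto
next
  case (Cons b e)
  then have b: "\<not> b" and "val e = 0" by (cases b; simp)+
  then obtain e' where IH: "steps (2 * length e + 1)
     (Decrement f, facing_left (map Digit e) (Digit True # r), y, z)
     (Skip, facing_right e' (Digit True # r), y, z)" using Cons.IH by blast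
  show ?case
    by (rule exI, rule steps_step[OF _ steps_trans[OF IH steps_1[OF _ zero_less_one] order.refl]])
      (use b in auto)
qed

text \<open>Listed from the last appended cell; the flag belongs to the one appended first.\<close>

fun new_cells :: "nat \<Rightarrow> bool \<Rightarrow> frame_cell list" where
  "new_cells 0 f = []"
| "new_cells (Suc k) f = new_cells k False @ [Frame_Cell False False False False f]"

text \<open>There are \<open>val e\<close> successful rounds and a failing one, each of at most
  \<open>2 * length e + 2\<close> steps.\<close>

lemma count_down:
  "\<exists>l. steps ((val e + 1) * (2 * length e + 2))
     (Decrement f, facing_left (map Digit e) (Sep # r), y, facing_right c [])
     (Check False, facing_right l r, y, facing_left (map Frame (new_cells (val e) f) @ c) [])"
proof (induction "val e" arbitrary: e f c)
  case 0
  then obtain e' where "steps (2 * length e + 1)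
     (Decrement f, facing_left (map Digit e) (Sep # r), y, facing_right c [])
     (Skip, facing_right e' (Sep # r), y, facing_right c [])"
    using decrement_0[of e] by metis
  moreover have "vstep (Skip, facing_right e' (Sep # r), y, facing_right c []) =
     (Check False, facing_right (Sep # e') r, y, facing_left c [])" by simp
  ultimately show ?case
    using 0 by (intro exI[of _ "Sep # e'"]) (rule steps_trans[OF _ steps_1[OF _ zero_less_one]], auto)
next
  case (Suc k)
  define c' where "c' = Frame (Frame_Cell False False False False f) # c"
  have k: "k = val (decrement e)" using Suc(2) val_decrement[of e] by simp
  obtain l where IH: "steps ((k + 1) * (2 * length e + 2))
     (Decrement False, facing_left (map Digit (decrement e)) (Sep # r), y, facing_right c' [])
     (Check False, facing_right l r, y, facing_left (map Frame (new_cells k False) @ c') [])"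
    using Suc(1)[OF k, of False c'] k by auto
  have "steps (2 * length e)
     (Decrement f, facing_left (map Digit e) (Sep # r), y, facing_right c [])
     (Forward False, facing_right (map Digit (decrement e)) (Sep # r), y, facing_right c' [])"
    unfolding c'_def by (rule decrement_pos) (use Suc(2) in simp)
  moreover have "steps (Suc ((k + 1) * (2 * length e + 2)))
     (Forward False, facing_right (map Digit (decrement e)) (Sep # r), y, facing_right c' [])
     (Check False, facing_right l r, y, facing_left (map Frame (new_cells k False) @ c') [])"
    by (rule steps_Suc[OF _ IH]) simp
  ultimately have "steps ((Suc k + 1) * (2 * length e + 2))
     (Decrement f, facing_left (map Digit e) (Sep # r), y, facing_right c [])
     (Check False, facing_right l r, y, facing_left (map Frame (new_cells k False) @ c') [])"
    by (rule steps_trans) simp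
  then show ?case unfolding Suc(2)[symmetric] c'_def by auto
qed

subsection \<open>Processing one coordinate\<close>

fun less_bits :: "bool \<Rightarrow> bool list \<Rightarrow> bool list \<Rightarrow> bool" where
  "less_bits lt (a # as) (b # bs) = less_bits (less_bit lt a b) as bs"
| "less_bits lt _ _ = lt"

lemma less_bit_iff:
  fixes x y :: nat
  shows "of_bool a + 2 * x < of_bool b + 2 * y \<or> of_bool a + 2 * x = of_bool b + 2 * y \<and> lt \<longleftrightarrow>
     x < y \<or> x = y \<and> less_bit lt a b"
  unfolding less_bit_def by (cases a; cases b) (simp_all; linarith)+

text \<open>The accumulator \<open>lt\<close> is the verdict on lower digits, so it only breaks ties
  of the remaining ones.\<close>

lemma less_bits_iff:
  "length as = length bs \<Longrightarrow>
     less_bits lt as bs \<longleftrightarrow> val as < val bs \<or> val as = val bs \<and> lt"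
proof (induction as bs arbitrary: lt rule: list_induct2)
  case (Cons a as b bs)
  show ?case
    unfolding less_bits.simps Cons.IH horner_sum_simps less_bit_iff ..
qed simp

lemma check_sweep:
  "steps (length c) (Check lt, x, y, facing_left (map Frame c) r)
     (Check (less_bits lt (map low c) (map high c)), x, y, facing_left [] (rev (map Frame c) @ r))"
  by (induction c arbitrary: lt r) (auto intro: steps_refl steps_Suc)

lemma to_end_sweep:
  "steps (length c + 1) (To_End, x, y, facing_right l (map Frame c))
     (Insert True False False, x, y, facing_left (rev (map Frame c) @ l) [])"
proof (induction c arbitrary: l)
  case Nil
  then show ?case by (intro steps_1) auto
qed (auto intro: steps_Suc)

text \<open>The stack reverses the digits, so the least significant one is popped first.
  \<open>To_End\<close> crosses the rest of the frame, whence the cost depends on the frame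
  alone.\<close>

lemma push_sweep:
  "length ds \<le> length c \<Longrightarrow>
   steps (length c + 2)
     (Push, facing_right l (map Digit ds @ Sep # r), facing_right s [], facing_right t (map Frame c))
     (Insert True False False, facing_right (Sep # rev (map Digit ds) @ l) r,
        facing_left (rev (map Digit ds) @ s) [], facing_left (rev (map Frame c) @ t) [])"
proof (induction c arbitrary: ds l s t)
  case Nil
  then show ?case
    by (auto intro!: steps_step[OF _ to_end_sweep[where c="[]", simplified]])
next
  case (Cons a c)
  show ?case
  proof (cases ds)
    case Nil
    then show ?thesis
      by (auto intro!: steps_step[OF _ to_end_sweep[where c="a # c", simplified]])
  next
    case (Cons d ds')
    then have "length ds' \<le> length c" using Cons.prems by simp
    from Cons.IH[OF this, of "Digit d # l" "Digit d # s" "Frame a # t"]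
    show ?thesis using Cons by (auto intro: steps_Suc)
  qed
qed

lemma push_overflow:
  "length c < length ds \<Longrightarrow>
   \<exists>x y z. steps (length c + 1)
     (Push, facing_right l (map Digit ds @ r), facing_right s [], facing_right t (map Frame c))
     (Reject, x, y, z)"
proof (induction c arbitrary: ds l s t)
  case Nil
  then obtain d ds' where "ds = d # ds'" by (cases ds) auto
  then show ?case by (intro exI, intro steps_1) auto
next
  case (Cons a c)
  then obtain d ds' where ds: "ds = d # ds'" "length c < length ds'" by (cases ds) auto
  obtain x y z where "steps (length c + 1)
     (Push, facing_right (Digit d # l) (map Digit ds' @ r), facing_right (Digit d # s) [],
       facing_right (Frame a # t) (map Frame c)) (Reject, x, y, z)"
    using Cons.IH[OF ds(2)] by blast
  then show ?case using ds by (intro exI, auto intro: steps_Suc)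
qed

text \<open>The result consists of the final borrow, the digits left over, and the new frame.\<close>

fun insert_bits :: "bool \<Rightarrow> bool list \<Rightarrow> frame_cell list \<Rightarrow> bool \<times> bool list \<times> frame_cell list" where
  "insert_bits br ds [] = (br, ds, [])"
| "insert_bits br ds (c # cs) =
     (if mark c
      then case insert_bits br ds cs of (br', ds', cs') \<Rightarrow>
        (br', ds', Frame_Cell (low c) (high c) False True True # cs')
      else let d = (ds \<noteq> [] \<and> hd ds) in case insert_bits (br \<and> \<not> d) (tl ds) cs of (br', ds', cs') \<Rightarrow>
        (br', ds', Frame_Cell (low c) (high c) (d \<noteq> br) d False # cs'))"

lemma insert_bits_tracks:
  assumes "insert_bits br ds cs = (br', ds', cs')"
  shows "map low cs' = map low cs" "map high cs' = map high cs" "map mark cs' = map mark cs"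
proof -
  have "map low (snd (snd (insert_bits br ds cs))) = map low cs \<and>
      map high (snd (snd (insert_bits br ds cs))) = map high cs \<and>
      map mark (snd (snd (insert_bits br ds cs))) = map mark cs"
    by (induction cs arbitrary: br ds) (simp_all add: Let_def case_prod_unfold)
  then show "map low cs' = map low cs" "map high cs' = map high cs" "map mark cs' = map mark cs"
    using assms by simp_all
qed

lemma insert_sweep:
  "insert_bits br ds cs = (br', ds', cs') \<Longrightarrow>
   steps (length cs)
     (Insert br gt lt, x, facing_left (map Digit ds) [], facing_left (map Frame cs) r)
     (Insert br' (less_bits gt (map low cs') (map new_low cs'))
        (less_bits lt (map new_high cs') (map high cs')),
      x, facing_left (map Digit ds') [], facing_left [] (rev (map Frame cs') @ r))"
proof (induction cs arbitrary: br gt lt ds br' ds' cs' r)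
  case Nil
  then show ?case by (auto intro: steps_refl)
next
  case (Cons c cs)
  show ?case
  proof (cases "mark c")
    case True
    with Cons.prems obtain cs'' where *: "insert_bits br ds cs = (br', ds', cs'')"
      "cs' = Frame_Cell (low c) (high c) False True True # cs''" by (auto split: prod.splits)
    show ?thesis
      using True * by (auto intro!: steps_Suc[OF _ Cons.IH[OF *(1), simplified]])
  next
    case False
    \<comment> \<open>An exhausted stack supplies leading zeros.\<close>
    define d where "d = (ds \<noteq> [] \<and> hd ds)"
    from False Cons.prems obtain cs'' where
      *: "insert_bits (br \<and> \<not> d) (tl ds) cs = (br', ds', cs'')"
      "cs' = Frame_Cell (low c) (high c) (d \<noteq> br) d False # cs''"
      by (auto simp: d_def Let_def split: prod.splits)
    note IH = Cons.IH[OF *(1), of "less_bit gt (low c) (d \<noteq> br)" "less_bit lt d (high c)"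
        "Frame (Frame_Cell (low c) (high c) (d \<noteq> br) d False) # r"]
    show ?thesis
    proof (cases ds)
      case Nil
      then show ?thesis using IH False *(2) by (auto simp: d_def intro!: steps_Suc)
    next
      case (Cons e ds2)
      then show ?thesis using IH False *(2) by (auto simp: d_def intro!: steps_Suc)
    qed
  qed
qed

text \<open>The sweep starts at the most significant cell; the carried flag \<open>m\<close> moves
  the mark one cell down, to the bit position of the next coordinate.\<close>

fun update_cells :: "bool \<Rightarrow> bool \<Rightarrow> bool \<Rightarrow> frame_cell list \<Rightarrow> frame_cell list" where
  "update_cells g l m [] = []"
| "update_cells g l m (c # cs) =
     Frame_Cell (if g then new_low c else low c) (if l then new_high c else high c)
       (new_low c) (new_high c) m # update_cells g l (mark c) cs"

lemma update_cells_tracks: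
  "map low (update_cells g l m cs) = map (if g then new_low else low) cs"
  "map high (update_cells g l m cs) = map (if l then new_high else high) cs"
  "map mark (update_cells g l m cs) = butlast (m # map mark cs)"
  by (induction cs arbitrary: m) auto

lemma update_sweep:
  "steps (length cs + 1) (Update g l m, x, y, facing_right t (map Frame cs))
     (Check False, x, y, facing_left (rev (map Frame (update_cells g l m cs)) @ t) [])"
proof (induction cs arbitrary: m t)
  case Nil
  then show ?case by (intro steps_1) auto
qed (auto intro: steps_Suc)

text \<open>Cells are counted from 1, least significant first, so that \<open>k\<close> is the
  number of coordinates still to come and 0 means no mark.\<close>

definition marked_at :: "nat \<Rightarrow> frame_cell list \<Rightarrow> bool" where
  "marked_at k cs \<longleftrightarrow> (\<forall>i<length cs. mark (cs ! i) \<longleftrightarrow> Suc i = k)"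

text \<open>Above the mark the sweep merely copies and subtracts the borrow. The empty remainder
  ensures that no digit of \<open>ds\<close> is cut off.\<close>

lemma insert_bits_unmarked:
  assumes "insert_bits br ds cs = (br', [], cs')" "marked_at 0 cs"
  shows "(br' \<longleftrightarrow> br \<and> val ds = 0) \<and> val (map new_high cs') = val ds \<and>
    (\<not> br' \<longrightarrow> val (map new_low cs') = val ds - of_bool br)"
  using assms
proof (induction cs arbitrary: br ds br' cs')
  case (Cons c cs)
  define d where "d = (ds \<noteq> [] \<and> hd ds)"
  have m: "\<not> mark c" "marked_at 0 cs" using Cons.prems(2) by (auto simp: marked_at_def All_less_Suc2)
  then obtain cs'' where *: "insert_bits (br \<and> \<not> d) (tl ds) cs = (br', [], cs'')"
      "cs' = Frame_Cell (low c) (high c) (d \<noteq> br) d False # cs''"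
    using Cons.prems(1) by (auto simp: d_def Let_def split: prod.splits)
  have "val ds = of_bool d + 2 * val (tl ds)" by (cases ds) (auto simp: d_def)
  then show ?case using Cons.IH[OF *(1) m(2)] *(2)
    by (cases br; cases d; cases br') auto
qed auto

text \<open>Below the mark each cell unfolds one step of \<open>insbit\<close>; at the mark the
  unmarked case takes over.\<close>

lemma insert_bits_marked:
  assumes "insert_bits br ds cs = (br', [], cs')" "marked_at (Suc p) cs" "p < length cs"
  shows "(br' \<longleftrightarrow> br \<and> val ds = 0) \<and> val (map new_high cs') = insbit True p (val ds) \<and>
    (\<not> br' \<longrightarrow> val (map new_low cs') = insbit False p (val ds - of_bool br))"
  using assms
proof (induction cs arbitrary: br ds br' cs' p)
  case (Cons c cs)
  show ?case
  proof (cases p)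
    case 0
    then have m: "mark c" "marked_at 0 cs" using Cons.prems(2)
      by (auto simp: marked_at_def All_less_Suc2)
    then obtain cs'' where *: "insert_bits br ds cs = (br', [], cs'')"
        "cs' = Frame_Cell (low c) (high c) False True True # cs''"
      using Cons.prems(1) by (auto split: prod.splits)
    show ?thesis using insert_bits_unmarked[OF *(1) m(2)] *(2) 0 by auto
  next
    case (Suc p')
    define d where "d = (ds \<noteq> [] \<and> hd ds)"
    have m: "\<not> mark c" "marked_at (Suc p') cs"
      using Cons.prems(2) Suc by (auto simp: marked_at_def All_less_Suc2)
    then obtain cs'' where *: "insert_bits (br \<and> \<not> d) (tl ds) cs = (br', [], cs'')"
        "cs' = Frame_Cell (low c) (high c) (d \<noteq> br) d False # cs''"
      using Cons.prems(1) by (auto simp: d_def Let_def split: prod.splits)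
    have v: "val ds = of_bool d + 2 * val (tl ds)" by (cases ds) (auto simp: d_def)
    have "p' < length cs" using Cons.prems(3) Suc by simp
    note IH = Cons.IH[OF *(1) m(2) this]
    \<comment> \<open>If no borrow is left at the end, a borrow passed on meets a nonzero rest, so
      the truncated subtraction has the right parity.\<close>
    have pos: "0 < val (tl ds)" if "\<not> br'" "br \<and> \<not> d"
      using IH that by (intro gr0I) simp
    have div: "(val ds - of_bool br) div 2 = val (tl ds) - of_bool (br \<and> \<not> d)"
      unfolding v by (cases br; cases d; cases "val (tl ds)") simp_all
    have mod: "(val ds - of_bool br) mod 2 = of_bool (d \<noteq> br)" if "\<not> br'"
      using pos[OF that] unfolding v by (cases br; cases d; cases "val (tl ds)") simp_all
    have "val ds div 2 = val (tl ds)" "val ds mod 2 = of_bool d" using v by simp_all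
    then have "val (map new_high cs') = insbit True p (val ds)"
      using IH *(2) Suc by simp
    moreover have "val (map new_low cs') = insbit False p (val ds - of_bool br)" if "\<not> br'"
      using IH that *(2) Suc div mod[OF that] by simp
    moreover have "br' \<longleftrightarrow> br \<and> val ds = 0"
      using IH v by auto
    ultimately show ?thesis by blast
  qed
qed auto

section \<open>Digits of the input, leftover digits and the moving mark\<close>

definition digits :: "nat \<Rightarrow> bool list" where
  "digits m = map (\<lambda>d. d = 1) (binary m)"

lemma val_digits: "val (rev (digits m)) = m"
proof (induction m rule: binary.induct)
  case (1 m)
  show ?case
  proof (cases "m < 2")
    case True
    then show ?thesis by (subst digits_def, subst binary.simps) auto
  next
    case False
    then have "digits m = digits (m div 2) @ [odd m]"
      unfolding digits_def by (subst binary.simps) (simp add: odd_iff_mod_2_eq_one)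
    then show ?thesis using 1 False by (simp add: of_bool_odd_eq_mod_2)
  qed
qed

lemma length_digits: "m < 2 ^ Suc n \<Longrightarrow> length (digits m) \<le> Suc n"
proof (induction n arbitrary: m)
  case (Suc n)
  then have "m div 2 < 2 ^ Suc n" by auto
  from Suc.IH[OF this] show ?case
    unfolding digits_def by (subst binary.simps) simp
qed (simp add: digits_def binary.simps)

definition symbols :: "nat \<Rightarrow> symbol list" where
  "symbols m = map Digit (digits m) @ [Sep]"

lemma insert_bits_unmarked_rest:
  "marked_at 0 cs \<Longrightarrow> fst (snd (insert_bits br ds cs)) = drop (length cs) ds"
proof (induction cs arbitrary: br ds)
  case (Cons c cs)
  then have "\<not> mark c" "marked_at 0 cs" by (auto simp: marked_at_def All_less_Suc2)
  then show ?case using Cons.IH by (simp add: Let_def case_prod_unfold drop_Suc)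
qed simp

text \<open>The marked cell pops nothing, so one digit fewer fits than there are cells.\<close>

lemma insert_bits_marked_rest:
  "marked_at (Suc p) cs \<Longrightarrow> p < length cs \<Longrightarrow>
     fst (snd (insert_bits br ds cs)) = drop (length cs - 1) ds"
proof (induction cs arbitrary: br ds p)
  case (Cons c cs)
  show ?case
  proof (cases p)
    case 0
    then have "mark c" "marked_at 0 cs"
      using Cons.prems by (auto simp: marked_at_def All_less_Suc2)
    then show ?thesis by (simp add: case_prod_unfold insert_bits_unmarked_rest)
  next
    case (Suc p')
    then have *: "\<not> mark c" "marked_at (Suc p') cs" "p' < length cs"
      using Cons.prems by (auto simp: marked_at_def All_less_Suc2)
    then have "length cs = Suc (length cs - 1)" by simp
    then show ?thesis using *(1) Cons.IH[OF *(2,3)]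
      by (simp add: Let_def case_prod_unfold drop_Suc[symmetric])
  qed
qed simp

text \<open>The update runs over the reversed list, so its shift drops the lowest mark and appends
  \<open>False\<close> at the top.\<close>

lemma marked_at_update:
  assumes "marked_at (Suc k) cs" "k < length cs"
  shows "marked_at k (rev (update_cells g l False (rev cs)))"
proof -
  define cs' where "cs' = rev (update_cells g l False (rev cs))"
  have "map mark cs' = rev (butlast (rev (map mark cs @ [False])))"
    by (simp add: cs'_def rev_map[symmetric] update_cells_tracks)
  then have m: "map mark cs' = tl (map mark cs @ [False])"
    by (simp only: butlast_rev rev_rev_ident)
  have len: "length cs' = length cs" using arg_cong[OF m, of length] by simp
  have "mark (cs' ! i) \<longleftrightarrow> Suc i = k" if "i < length cs" for i
  proof -
    have "mark (cs' ! i) = map mark cs' ! i" using that len by simp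
    also have "\<dots> = (map mark cs @ [False]) ! Suc i" unfolding m using that by (simp add: nth_tl)
    also have "\<dots> \<longleftrightarrow> Suc i = k"
      using that assms by (auto simp: nth_append marked_at_def)
    finally show ?thesis .
  qed
  then show ?thesis using len by (simp add: marked_at_def cs'_def)
qed

text \<open>Loop invariant: the frame holds the current bounds, the mark is at the position of the
  next coordinate and the stack is blank. A full round of check, push, insert and update takes at
  most \<open>4 * n + 9\<close> steps.\<close>

lemma decide_coordinates:
  assumes "length cs = Suc n" "length ws \<le> n" "marked_at (length ws) cs" "val (map high cs) \<le> 2 ^ n"
  shows "\<exists>x y z. steps (length ws * (4 * n + 9) + n + 4)
     (Check False, facing_right l (concat (map symbols ws)), facing_left [] [],
        facing_left (map Frame cs) [])
     (if feasible (val (map low cs)) (val (map high cs)) ws then Accept else Reject, x, y, z)"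
  using assms
proof (induction ws arbitrary: cs l)
  case Nil
  note [simp] = Nil(1)
  let ?lt = "val (map low cs) < val (map high cs)"
  have s1: "steps (Suc n)
     (Check False, facing_right l [], facing_left [] [], facing_left (map Frame cs) [])
     (Check ?lt, facing_right l [], facing_left [] [], facing_left [] (rev (map Frame cs)))"
    using check_sweep[of cs False _ _ "[]"] by (simp add: less_bits_iff)
  have "\<exists>z. steps 2
     (Check ?lt, facing_right l [], facing_left [] [], facing_left [] (rev (map Frame cs)))
     (if ?lt then Accept else Reject, facing_right l [], facing_left [] [], z)"
  proof (cases ?lt)
    case True
    then show ?thesis by (intro exI, intro steps_step[OF _ steps_1[OF _ zero_less_one]]) auto
  next
    case False
    then show ?thesis by (intro exI, intro steps_1) auto
  qed
  then obtain z where s2: "steps 2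
     (Check ?lt, facing_right l [], facing_left [] [], facing_left [] (rev (map Frame cs)))
     (if ?lt then Accept else Reject, facing_right l [], facing_left [] [], z)" ..
  have "steps (n + 4)
     (Check False, facing_right l [], facing_left [] [], facing_left (map Frame cs) [])
     (if ?lt then Accept else Reject, facing_right l [], facing_left [] [], z)"
    by (rule steps_trans[OF s1 s2]) simp
  then show ?case by (simp split del: if_split) blast
next
  case (Cons w ws)
  let ?p = "length ws"
  let ?A = "val (map low cs)" and ?B = "val (map high cs)" and ?ws = "concat (map symbols ws)"
  let ?c0 = "(Check False, facing_right l (concat (map symbols (w # ws))), facing_left [] [],
        facing_left (map Frame cs) [])"
  define ds where "ds = digits w"
  have len: "length cs = Suc n" and p: "?p < n" using Cons.prems by simp_all
  have x: "concat (map symbols (w # ws)) = map Digit ds @ Sep # ?ws"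
    by (simp add: symbols_def ds_def)
  have s1: "steps (Suc n) ?c0 (Check (?A < ?B), facing_right l (map Digit ds @ Sep # ?ws),
       facing_left [] [], facing_left [] (map Frame (rev cs)))"
    using check_sweep[of cs False _ _ "[]"] len
    unfolding x by (simp add: less_bits_iff rev_map)
  \<comment> \<open>Here \<open>n > 0\<close> because \<open>?p < n\<close>, so
    \<open>length_digits\<close> applies with \<open>n - 1\<close>.\<close>
  have large: "\<not> feasible ?A ?B (w # ws)" if "n < length ds"
  proof (rule infeasible_large)
    show "2 ^ n \<le> w" using length_digits[of w "n - 1"] that p unfolding ds_def by (cases n) force+
  qed (use p Cons.prems in auto)
  \<comment> \<open>The slack \<open>5 * n + 13\<close> is one round plus the final
    \<open>n + 4\<close>.\<close>
  have reject: ?case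
    if "steps T ?c0 (Reject, x, y, z)" "T \<le> 5 * n + 13" "\<not> feasible ?A ?B (w # ws)" for T x y z
  proof -
    have "steps (length (w # ws) * (4 * n + 9) + n + 4) ?c0 (Reject, x, y, z)"
      by (rule steps_trans[OF that(1) steps_refl[of 0]]) (use that(2) in simp)
    then show ?thesis unfolding if_not_P[OF that(3)] by blast
  qed
  show ?case
  proof (cases "?A < ?B")
    case False
    then have "\<not> feasible ?A ?B (w # ws)" using feasible_less[of ?A ?B "w # ws"] by blast
    moreover have "steps (n + 2) ?c0 (Reject, facing_right l (map Digit ds @ Sep # ?ws),
       facing_left [] [], facing_left [] (map Frame (rev cs)))"
      by (rule steps_trans[OF s1 steps_1[OF _ zero_less_one]]) (use False in auto)
    ultimately show ?thesis by (intro reject) auto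
  next
    case less: True
    have s2: "steps (n + 2) ?c0 (Push, facing_right l (map Digit ds @ Sep # ?ws),
       facing_right [] [], facing_right [] (map Frame (rev cs)))"
      by (rule steps_trans[OF s1 steps_1[OF _ zero_less_one]]) (use less in \<open>auto simp: facing_Nil\<close>)
    show ?thesis
    proof (cases "length ds \<le> Suc n")
      case False
      then obtain x y z where "steps (n + 2) (Push, facing_right l (map Digit ds @ Sep # ?ws),
         facing_right [] [], facing_right [] (map Frame (rev cs))) (Reject, x, y, z)"
        using push_overflow[of "rev cs" ds l "Sep # ?ws" "[]" "[]"] len by auto
      from steps_trans[OF s2 this order.refl] show ?thesis
        by (rule reject) (use False large in auto)
    next
      case True
      define l' where "l' = Sep # rev (map Digit ds) @ l"
      have s3: "steps (2 * n + 5) ?c0 (Insert True False False, facing_right l' ?ws,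
         facing_left (map Digit (rev ds)) [], facing_left (map Frame cs) [])"
        using push_sweep[of ds "rev cs" l ?ws "[]" "[]"] True len
        by (intro steps_trans[OF s2]) (auto simp: rev_map l'_def)
      obtain br ds' cs' where ins: "insert_bits True (rev ds) cs = (br, ds', cs')"
        by (cases "insert_bits True (rev ds) cs")
      note tracks = insert_bits_tracks[OF ins]
      have len': "length cs' = Suc n" using arg_cong[OF tracks(1), of length] len by simp
      have ds': "ds' = drop n (rev ds)"
        using insert_bits_marked_rest[of ?p cs True "rev ds"] Cons.prems ins p by simp
      let ?gt = "val (map low cs') < val (map new_low cs')"
        and ?lt = "val (map new_high cs') < val (map high cs')"
      have s4: "steps (3 * n + 6) ?c0 (Insert br ?gt ?lt, facing_right l' ?ws,
         facing_left (map Digit ds') [], facing_left [] (map Frame (rev cs')))"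
        using insert_sweep[OF ins, of False False _ "[]"] len
        by (intro steps_trans[OF s3]) (auto simp: rev_map less_bits_iff)
      show ?thesis
      proof (cases ds')
        \<comment> \<open>Exactly \<open>n + 1\<close> digits: they pass \<open>Push\<close>, but
          the marked cell leaves one on the stack.\<close>
        case (Cons d ds'')
        then have "n < length ds" using ds' by (metis drop_all length_rev list.distinct(1) not_le)
        moreover have "steps (3 * n + 7) ?c0 (Reject, facing_right l' ?ws, facing_left (map Digit ds') [],
             facing_left [] (map Frame (rev cs')))"
          by (rule steps_trans[OF s4 steps_1[OF _ zero_less_one]]) (use Cons in auto)
        ultimately show ?thesis using large by (intro reject) auto
      next
        case Nil
        define cs'' where "cs'' = rev (update_cells (?gt \<and> \<not> br) ?lt False (rev cs'))"
        have s5: "steps (3 * n + 7) ?c0 (Update (?gt \<and> \<not> br) ?lt False, facing_right l' ?ws,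
           facing_left [] [], facing_right [] (map Frame (rev cs')))"
          by (rule steps_trans[OF s4 steps_1[OF _ zero_less_one]]) (auto simp: Nil)
        have "steps (n + 2) (Update (?gt \<and> \<not> br) ?lt False, facing_right l' ?ws,
           facing_left [] [], facing_right [] (map Frame (rev cs')))
           (Check False, facing_right l' ?ws, facing_left [] [], facing_left (map Frame cs'') [])"
          using update_sweep[of "rev cs'" "?gt \<and> \<not> br" ?lt False _ _ "[]"] len'
          by (simp add: rev_map cs''_def)
        then have s6: "steps (4 * n + 9) ?c0 (Check False, facing_right l' ?ws,
           facing_left [] [], facing_left (map Frame cs'') [])"
          by (rule steps_trans[OF s5]) simp
        have new: "br \<longleftrightarrow> w = 0" "val (map new_high cs') = insbit True ?p w"
          "\<not> br \<Longrightarrow> val (map new_low cs') = insbit False ?p (w - 1)"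
          using insert_bits_marked[of True "rev ds" cs br cs' ?p] ins Nil Cons.prems p
          by (auto simp: ds_def val_digits)
        \<comment> \<open>A final borrow signals \<open>w = 0\<close>; \<open>new_low\<close> is
          then discarded, the true bound being 0.\<close>
        have low: "val (map low cs'') = max ?A (insbit False ?p (w - 1))"
          using new tracks by (cases br) (auto simp: cs''_def update_cells_tracks rev_map[symmetric] insbit_0)
        have high: "val (map high cs'') = min ?B (insbit True ?p w)"
          using new tracks by (auto simp: cs''_def update_cells_tracks rev_map[symmetric])
        have "marked_at (Suc ?p) cs'"
          using Cons.prems(3) tracks(3) len len' by (metis length_Cons length_map marked_at_def nth_map)
        then have "marked_at ?p cs''"
          unfolding cs''_def by (rule marked_at_update) (use len' p in simp)
        moreover have "length cs'' = Suc n"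
          using arg_cong[OF update_cells_tracks(1), of length] len' by (simp add: cs''_def)
        moreover have "val (map high cs'') \<le> 2 ^ n" unfolding high using Cons.prems(4) by simp
        ultimately obtain x y z where "steps (?p * (4 * n + 9) + n + 4)
           (Check False, facing_right l' ?ws, facing_left [] [], facing_left (map Frame cs'') [])
           (if feasible (val (map low cs'')) (val (map high cs'')) ws then Accept else Reject, x, y, z)"
          using Cons.IH[of cs'' l'] p by auto
        then have "steps (length (w # ws) * (4 * n + 9) + n + 4) ?c0
           (if feasible ?A ?B (w # ws) then Accept else Reject, x, y, z)"
          unfolding low high feasible.simps by (rule steps_trans[OF s6]) simp
        then show ?thesis by blast
      qed
    qed
  qed
qed

section \<open>The complete run\<close>

lemma new_cells_tracks:
  "length (new_cells k f) = k"
  "map low (new_cells k f) = replicate k False"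
  "map high (new_cells k f) = replicate k False"
  "map mark (new_cells (Suc k) f) = replicate k False @ [f]"
proof -
  have len: "length (new_cells k f) = k" for k f
    by (induction k f rule: new_cells.induct) auto
  then show "length (new_cells k f) = k" .
  show "map low (new_cells k f) = replicate k False" "map high (new_cells k f) = replicate k False"
    by (induction k f rule: new_cells.induct) (auto simp: replicate_append_same)
  have "map mark (new_cells k False) = replicate k False" for k
    by (induction k) (auto simp: replicate_append_same)
  then show "map mark (new_cells (Suc k) f) = replicate k False @ [f]" by simp
qed

lemma val_replicate_False: "val (replicate k False) = 0"
  by (induction k) auto

text \<open>The frame costs at most \<open>n + 3 + (n + 1) * (2 * n + 4)\<close> steps, the
  coordinates \<open>n * (4 * n + 9) + n + 4\<close>.\<close>

lemma decide:
  assumes "length w = n"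
  shows "\<exists>x y z. steps (6 * n ^ 2 + 17 * n + 11)
     (Start, facing_right [] (symbols n @ concat (map symbols w)), facing_right [] [], facing_right [] [])
     (if feasible 0 (2 ^ n) w then Accept else Reject, x, y, z)"
proof -
  let ?w = "concat (map symbols w)"
  let ?c0 = "(Start, facing_right [] (symbols n @ ?w), facing_right [] [], facing_right [] [])"
  \<comment> \<open>The cell written by \<open>Start\<close> makes the initial upper bound
    \<open>2 ^ n\<close>.\<close>
  define top where "top = Frame_Cell False True False False False"
  define ds where "ds = digits n"
  define cs where "cs = new_cells n True @ [top]"
  have sym: "symbols n = map Digit ds @ [Sep]" by (simp add: symbols_def ds_def)
  have "n < 2 ^ Suc n" by (rule less_trans[OF less_exp]) simp
  from length_digits[OF this] have len: "length ds \<le> Suc n" by (simp add: ds_def)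
  have "steps 1 ?c0 (Forward True, facing_right [] (map Digit ds @ Sep # ?w), facing_right [] [],
     facing_right [Frame top] [])"
    by (intro steps_1) (auto simp: sym top_def)
  from steps_trans[OF this forward_digits order.refl]
  have s1: "steps (n + 2) ?c0 (Forward True, facing_right (rev (map Digit ds)) (Sep # ?w),
     facing_right [] [], facing_right [Frame top] [])"
    using len by (auto intro: steps_trans[OF _ steps_refl[of 0]])
  have s2: "steps (n + 3) ?c0 (Decrement True, facing_left (map Digit (rev ds)) (Sep # ?w),
     facing_right [] [], facing_right [Frame top] [])"
    by (rule steps_trans[OF s1 steps_1[OF _ zero_less_one]]) (auto simp: rev_map)
  obtain l where count: "steps ((n + 1) * (2 * length ds + 2))
     (Decrement True, facing_left (map Digit (rev ds)) (Sep # ?w),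
       facing_right [] [], facing_right [Frame top] [])
     (Check False, facing_right l ?w, facing_left [] [], facing_left (map Frame cs) [])"
    using count_down[of "rev ds" True ?w "facing_right [] []" "[Frame top]"]
    by (auto simp: ds_def val_digits cs_def facing_Nil)
  have "(n + 1) * (2 * length ds + 2) \<le> (n + 1) * (2 * n + 4)"
    using len by (intro mult_le_mono) auto
  then have s3: "steps (n + 3 + (n + 1) * (2 * n + 4)) ?c0
     (Check False, facing_right l ?w, facing_left [] [], facing_left (map Frame cs) [])"
    by (intro steps_trans[OF s2 count]) linarith
  \<comment> \<open>The cell next to \<open>top\<close> has bit position \<open>n - 1\<close>, that
    of the first coordinate; for \<open>n = 0\<close> nothing is marked.\<close>
  have "mark (cs ! i) \<longleftrightarrow> Suc i = n" if "i < Suc n" for i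
  proof -
    have "map mark cs = (if n = 0 then [False] else replicate (n - 1) False @ [True, False])"
      using new_cells_tracks(4)[of "n - 1" True] by (cases n) (simp_all add: cs_def top_def)
    then have "map mark cs ! i \<longleftrightarrow> Suc i = n" using that by (auto simp: nth_append nth_Cons')
    moreover have "length cs = Suc n" by (simp add: cs_def new_cells_tracks)
    ultimately show ?thesis using that by (metis nth_map)
  qed
  then have "marked_at (length w) cs"
    using assms by (simp add: marked_at_def cs_def new_cells_tracks)
  moreover have "val (map low cs) = 0" "val (map high cs) = 2 ^ n"
    by (simp_all add: cs_def top_def new_cells_tracks horner_sum_append val_replicate_False)
  moreover have "length cs = Suc n" by (simp add: cs_def new_cells_tracks)
  ultimately obtain x y z where "steps (n * (4 * n + 9) + n + 4)
     (Check False, facing_right l ?w, facing_left [] [], facing_left (map Frame cs) [])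
     (if feasible 0 (2 ^ n) w then Accept else Reject, x, y, z)"
    using decide_coordinates[of cs n w l] assms by auto
  then have "steps (6 * n ^ 2 + 17 * n + 11) ?c0
     (if feasible 0 (2 ^ n) w then Accept else Reject, x, y, z)"
    by (rule steps_trans[OF s3]) (simp add: power2_eq_square algebra_simps)
  then show ?thesis by blast
qed

section \<open>Numbering states and symbols\<close>

text \<open>Codes 0 to 3 are dictated by the blank and the input encoding; the 32 frame cells fill 4
  to 35.\<close>

fun symbol_code :: "symbol \<Rightarrow> nat" where
  "symbol_code Blank = 0"
| "symbol_code (Digit b) = Suc (of_bool b)"
| "symbol_code Sep = 3"
| "symbol_code (Frame c) = 4 + val [low c, high c, new_low c, new_high c, mark c]"

lemma symbol_code_less: "symbol_code s < 36"
  by (induction s rule: symbol_code.induct) (auto simp: of_bool_def)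

lemma val_inject: "length as = length bs \<Longrightarrow> val as = val bs \<Longrightarrow> as = bs"
proof (induction as bs rule: list_induct2)
  case (Cons a as b bs)
  then have "of_bool a + 2 * val as = of_bool b + 2 * val bs" by simp
  then have "a = b" "val as = val bs" by (cases a; cases b; simp; presburger)+
  then show ?case using Cons.IH by simp
qed simp

lemma symbol_code_inject: "symbol_code s = symbol_code t \<longleftrightarrow> s = t"
proof
  assume *: "symbol_code s = symbol_code t"
  have less: "Suc (of_bool b) < 3" for b by (cases b) simp_all
  show "s = t"
  proof (cases s; cases t)
    fix c d
    assume st: "s = Frame c" "t = Frame d"
    with * have "val [low c, high c, new_low c, new_high c, mark c] =
        val [low d, high d, new_low d, new_high d, mark d]" by simp
    from val_inject[OF _ this] show "s = t" using st by (simp add: frame_cell.expand)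
  qed (use * less in \<open>auto simp: of_bool_def split: if_splits\<close>)
qed simp

lemma inj_symbol_code: "inj symbol_code"
  by (rule injI) (simp add: symbol_code_inject)

definition machine :: "(state \<Rightarrow> nat) \<Rightarrow> nat \<Rightarrow> tm" where
  "machine code N =
     \<lparr>num_tapes = 3, num_symbols = 36, num_states = N,
      init_state = code Start, acc_state = code Accept, rej_state = code Reject,
      trans = \<lambda>q ss.
        case delta (inv code q) (inv symbol_code (ss ! 0)) (inv symbol_code (ss ! 1))
            (inv symbol_code (ss ! 2)) of
          (q', (a, ma), (b, mb), (c, mc)) \<Rightarrow>
            (code q', [(symbol_code a, ma), (symbol_code b, mb), (symbol_code c, mc)])\<rparr>"

lemma wf_machine:
  assumes "inj code" "\<And>q. code q < N"
  shows "wf_tm (machine code N)"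
  using assms symbol_code_less
  by (auto simp: wf_tm_def machine_def inj_eq split: prod.splits)

section \<open>Simulation of the head-centred runs by the Turing machine\<close>

definition shows_view :: "tape \<Rightarrow> view \<Rightarrow> bool" where
  "shows_view t v \<longleftrightarrow> (\<forall>k. fst t (snd t + k) = symbol_code (v k))"

fun represents :: "(state \<Rightarrow> nat) \<Rightarrow> config \<Rightarrow> state \<times> view \<times> view \<times> view \<Rightarrow> bool" where
  "represents code c (q, x, y, z) \<longleftrightarrow>
     (\<exists>r s t. c = (code q, [r, s, t]) \<and> shows_view r x \<and> shows_view s y \<and> shows_view t z)"

lemma shows_view_act:
  assumes "shows_view t v"
  shows "shows_view (act_tape (symbol_code s, m) t) (act (s, m) v)"
proof -
  have move: "move_head m h = h + offset m" for h by (cases m) auto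
  have "fst t j = symbol_code (v (j - snd t))" for j
    using assms unfolding shows_view_def by (metis add_diff_cancel_left' diff_add_cancel add.commute)
  then show ?thesis
    by (auto simp: shows_view_def act_tape_def act_def move algebra_simps)
qed

lemma read_shows_view: "shows_view t v \<Longrightarrow> read_tape t = symbol_code (v 0)"
  unfolding shows_view_def read_tape_def by (metis add.right_neutral)

lemma represents_step:
  assumes code: "inj code" and c: "represents code c v"
  shows "represents code (step (machine code N) c) (vstep v)"
proof -
  obtain q x y z where v: "v = (q, x, y, z)" by (cases v)
  with c obtain r s t where c_eq: "c = (code q, [r, s, t])"
    and views: "shows_view r x" "shows_view s y" "shows_view t z" by auto
  show ?thesis
  \<comment> \<open>In a halting state \<open>step\<close> freezes the configuration, while
    \<open>delta\<close> rewrites what it reads and stays.\<close>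
  proof (cases "q = Accept \<or> q = Reject")
    case True
    then show ?thesis using v c_eq views by (auto simp: step_def machine_def)
  next
    case False
    obtain q' a ma b mb d md where d: "delta q (x 0) (y 0) (z 0) = (q', (a, ma), (b, mb), (d, md))"
      by (metis prod.exhaust)
    have "step (machine code N) c = (code q',
        [act_tape (symbol_code a, ma) r, act_tape (symbol_code b, mb) s, act_tape (symbol_code d, md) t])"
      using False code d
      by (simp add: step_def c_eq machine_def inj_eq read_shows_view[OF views(1)]
          read_shows_view[OF views(2)] read_shows_view[OF views(3)] inj_symbol_code)
    then show ?thesis using v d views by (auto intro: shows_view_act)
  qed
qed

lemma shows_view_input:
  "shows_view (input_tape (map symbol_code xs)) (facing_right [] xs)"
  by (auto simp: shows_view_def input_tape_def facing_right_def nth_default_def nat_less_iff)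

lemma represents_init:
  "represents code (init_config (machine code N) (map symbol_code xs))
     (Start, facing_right [] xs, facing_right [] [], facing_right [] [])"
proof -
  have "init_config (machine code N) (map symbol_code xs) =
      (code Start, [input_tape (map symbol_code xs), input_tape [], input_tape []])"
    by (simp add: init_config_def machine_def numeral_2_eq_2)
  then show ?thesis using shows_view_input[of xs] shows_view_input[of "[]"]
    unfolding represents.simps list.map by blast
qed

lemma run_machine:
  assumes "inj code" "steps T (Start, facing_right [] xs, facing_right [] [], facing_right [] []) (q, x, y, z)"
  shows "\<exists>t\<le>T. fst (run (machine code N) (map symbol_code xs) t) = code q"
proof -
  let ?c = "(Start, facing_right [] xs, facing_right [] [], facing_right [] [])"
  have "represents code (run (machine code N) (map symbol_code xs) t) ((vstep ^^ t) ?c)" for t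
  proof (induction t)
    case 0
    show ?case by (simp only: run_def funpow_0 represents_init)
  next
    case (Suc t)
    show ?case using represents_step[OF assms(1) Suc, of N] by (simp add: run_def)
  qed
  then show ?thesis using assms(2) unfolding steps_def by (metis represents.simps fst_conv)
qed

section \<open>Input encoding and finiteness of the state set\<close>

lemma encode_num_symbols: "encode_num m = map symbol_code (symbols m)"
proof -
  have "set (binary m) \<subseteq> {0, 1}"
  proof (induction m rule: binary.induct)
    case (1 m)
    then show ?case by (subst binary.simps) auto
  qed
  then have "map Suc (binary m) = map (\<lambda>d. Suc (of_bool (d = 1))) (binary m)"
    by (intro map_cong) auto
  then show ?thesis by (simp add: encode_num_def symbols_def digits_def)
qed

lemma encode_symbols: "encode n w = map symbol_code (symbols n @ concat (map symbols w))"
proof -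
  have "encode_num = map symbol_code \<circ> symbols" by (rule ext) (simp add: encode_num_symbols)
  then show ?thesis by (simp add: encode_def map_concat encode_num_symbols)
qed

lemma finite_states: "finite (UNIV :: state set)"
proof -
  have "q \<in> {Start, Skip, Push, To_End, Accept, Reject} \<union>
      (\<Union>a. {Forward a, Decrement a, Check a}) \<union> (\<Union>a b c. {Insert a b c, Update a b c})" for q
    by (cases q) auto
  then show ?thesis by (rule finite_subset[OF subsetI]) simp
qed

theorem theorem18:
  "\<exists>(M :: tm) (p :: nat poly). wf_tm M \<and>
     (\<forall>(n :: nat) (w :: nat list). length w = n \<longrightarrow>
        (if cyclic_hyper_degree n w
         then accepts_within M (encode n w) (poly p n)
         else rejects_within M (encode n w) (poly p n)))"
proof -
  obtain code :: "state \<Rightarrow> nat" and N where code: "code ` UNIV = {i. i < N}" "inj code"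
    using finite_imp_inj_to_nat_seg[OF finite_states] by blast
  define M where "M = machine code N"
  define p :: "nat poly" where "p = [:11, 17, 6:]"
  have p: "poly p n = 6 * n ^ 2 + 17 * n + 11" for n
    by (simp add: p_def power2_eq_square algebra_simps)
  have "wf_tm M" unfolding M_def by (rule wf_machine) (use code in auto)
  moreover have "if cyclic_hyper_degree n w
         then accepts_within M (encode n w) (poly p n)
         else rejects_within M (encode n w) (poly p n)" if len: "length w = n" for n w
  proof -
    obtain x y z where *: "steps (poly p n)
       (Start, facing_right [] (symbols n @ concat (map symbols w)), facing_right [] [], facing_right [] [])
       (if cyclic_hyper_degree n w then Accept else Reject, x, y, z)"
      using decide[OF len] cyclic_hyper_degree_iff_feasible[OF len] p by auto
    show ?thesis
      using run_machine[OF code(2) *, of N] unfolding encode_symbols M_def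
      by (auto simp: accepts_within_def rejects_within_def machine_def)
  qed
  ultimately show ?thesis by blast
qed

end
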